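(* The set $k^{-1}(3)\subset\mathbb{R}$ is not $G_\delta$ and not $F_\sigma$, but it is $F_{\sigma\delta}$.
   Context: For $x\in\mathbb{R}\setminus\mathbb{Q}$, the best constant of Diophantine approximation is $$k(x)=\sup\Big\{c>0 : \Big|x-\frac pq\Big|<\frac{1}{cq^2}\text{ has infinitely many solutions }\frac pq\in\mathbb{Q}\Big\}\in(0,\infty],$$ and $k^{-1}(3)=\{x\in\mathbb{R}\setminus\mathbb{Q}: k(x)=3\}$. A set is $G_\delta$ if it is a countable intersection of open subsets of $\mathbb{R}$, $F_\sigma$ if it is a countable union of closed subsets of $\mathbb{R}$, and $F_{\sigma\delta}$ if it is a countable intersection of $F_\sigma$ sets. *)

theory Defs
  imports "HOL-Analysis.Analysis"
begin

(* Solutions are collected as rational values p/q, not as pairs (p, q), so each rational is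
   counted once.  Fractions need not be in lowest terms: reducing p/q only weakens the
   inequality to be satisfied, so the set of values is the same either way. *)
definition approx_solutions :: "real \<Rightarrow> real \<Rightarrow> real set" where
  "approx_solutions c x =
     {of_int p / of_nat q | (p :: int) (q :: nat).
        q > 0 \<and> \<bar>x - of_int p / of_nat q\<bar> < 1 / (c * (of_nat q)\<^sup>2)}"

(* The supremum is taken in the extended reals, as it can be infinite.  The value is only
   meaningful for irrational x; for rational x the set below is empty. *)
definition approx_const :: "real \<Rightarrow> ereal" where
  "approx_const x = Sup (ereal ` {c. c > 0 \<and> infinite (approx_solutions c x)})"

definition approx_const_fiber :: "ereal \<Rightarrow> real set" where
  "approx_const_fiber t = {x. x \<notin> \<rat> \<and> approx_const x = t}"

definition fsigma_delta :: "'a::topological_space set \<Rightarrow> bool" where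
  "fsigma_delta S \<longleftrightarrow> (\<exists>F :: nat \<Rightarrow> 'a set. (\<forall>n. fsigma (F n)) \<and> S = (\<Inter>n. F n))"

end

theory Submission
  imports Defs
begin

text \<open>For irrational \<open>x\<close>, having infinitely many solutions with constant \<open>c\<close> means having solutions
  with arbitrarily large denominators, a \<open>G\<^sub>\<delta>\<close> condition. Hence \<open>k(x) \<ge> 3\<close> is a \<open>G\<^sub>\<delta>\<close> condition and
  \<open>k(x) \<le> 3\<close> a countable intersection of \<open>F\<^sub>\<sigma>\<close> conditions.

  For the negative parts, send a sequence \<open>n\<close> of naturals to the continued fraction obtained by
  concatenating the blocks \<open>1\<^sup>2\<^sup>m 2 2 1\<^sup>2\<^sup>m\<^sup>+\<^sup>1 2 2 1\<^sup>2\<^sup>m\<close> for \<open>m = n\<^sub>0, n\<^sub>1, \<dots>\<close>. By Legendre's theorem \<open>k\<close> is the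
  upper limit of \<open>[a\<^sub>t; a\<^sub>t\<^sub>+\<^sub>1, \<dots>] + [0; a\<^sub>t\<^sub>-\<^sub>1, \<dots>, a\<^sub>0]\<close>. At a 1 this is at most 3; at a pair of 2s
  surrounded by infinitely many 1s it would be exactly \<open>2 + 1 / (2 + g) + g = 3\<close> with
  \<open>g = (\<surd>5 - 1) / 2\<close>, so \<open>k = 3\<close> if \<open>n\<close> tends to infinity. If not, some \<open>m\<close> recurs, and the second
  pair of its block, with an odd run to the left and an even one to the right, pushes \<open>k\<close> above 3
  by a fixed amount. So the fibre pulls back to the set of sequences tending to infinity, which is neither
  \<open>G\<^sub>\<delta>\<close> nor \<open>F\<^sub>\<sigma>\<close> by a diagonal argument.\<close>

section \<open>Diagonal arguments in Baire space\<close>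

text \<open>Dependent choice builds ever longer frozen prefixes: stage \<open>k\<close> may change
  entries only from \<open>L k\<close> on, so the stages have a common limit \<open>m\<close>, and
  whatever a finite prefix guarantees survives in it.\<close>

lemma fusion:
  fixes P :: "nat \<Rightarrow> nat \<Rightarrow> (nat \<Rightarrow> 'a) \<Rightarrow> nat \<Rightarrow> bool"
  assumes step: "\<And>k n l. \<exists>n' l'. l < l' \<and> (\<forall>i<l. n' i = n i) \<and> P k l n' l'"
  obtains m N L where "\<And>k. L k < L (Suc k)" "\<And>k i. i < L k \<Longrightarrow> m i = N k i"
    "\<And>k. P k (L k) (N (Suc k)) (L (Suc k))"
proof -
  define R where "R k x y \<longleftrightarrow> snd x < snd y \<and> (\<forall>i<snd x. fst y i = fst x i) \<and> P k (snd x) (fst y) (snd y)"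
    for k and x y :: "(nat \<Rightarrow> 'a) \<times> nat"
  have "\<exists>y. R k x y" for k x
    using step[of "snd x" "fst x" k] by (auto simp: R_def)
  then obtain F where F: "\<And>k. R k (F k) (F (Suc k))"
    using dependent_nat_choice[of "\<lambda>_ _. True" R] by auto
  define N L where "N k = fst (F k)" and "L k = snd (F k)" for k
  have L: "L k < L (Suc k)" and N: "i < L k \<Longrightarrow> N (Suc k) i = N k i"
    and P: "P k (L k) (N (Suc k)) (L (Suc k))" for k i
    using F[of k] by (auto simp: N_def L_def R_def)
  have stable: "N (k + j) i = N k i" if "i < L k" for k j i
  proof (induction j)
    case (Suc j)
    have "L k \<le> L (k + j)"
      by (rule lift_Suc_mono_le) (use L in \<open>auto simp: less_imp_le\<close>)
    then show ?case
      using N[of i "k + j"] Suc that by simp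
  qed simp
  have "strict_mono L"
    using L by (simp add: strict_mono_Suc_iff)
  then have L_ge: "i < L (Suc i)" for i
    using strict_mono_imp_increasing[of L "Suc i"] by (simp add: Suc_le_eq)
  \<comment> \<open>Entry \<open>i\<close> is frozen by stage \<open>Suc i\<close> at the latest, so
    the diagonal \<open>N (Suc i) i\<close> serves as the limit.\<close>
  have "N (Suc i) i = N k i" if "i < L k" for k i
    using stable[OF that, of "Suc i"] stable[OF L_ge, of i k] by (simp add: add.commute)
  with L P show ?thesis
    by (intro that[of L "\<lambda>i. N (Suc i) i" N])
qed

text \<open>Since \<open>k \<le> L k\<close>, only finitely many \<open>k\<close> satisfy
  \<open>L k \<le> i\<close>; take the greatest. It serves below for prefix lengths, denominators of
  convergents and starts of blocks.\<close>

lemma between_steps: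
  fixes L :: "nat \<Rightarrow> nat"
  assumes "\<And>k. k \<le> L k" "L K \<le> i"
  obtains k where "K \<le> k" "L k \<le> i" "i < L (Suc k)"
proof -
  have bound: "L k \<le> i \<Longrightarrow> k \<le> i" for k
    using assms(1)[of k] by simp
  define k where "k = (GREATEST k. L k \<le> i)"
  have "L k \<le> i" "K \<le> k"
    unfolding k_def using GreatestI_nat[of "\<lambda>k. L k \<le> i" K i] Greatest_le_nat[of "\<lambda>k. L k \<le> i" K i]
     assms(2) bound by auto
  moreover have "\<not> L (Suc k) \<le> i"
    using Greatest_le_nat[of "\<lambda>k. L k \<le> i" "Suc k" i] bound unfolding k_def by fastforce
  ultimately show ?thesis
    using that by auto
qed

text \<open>Hypothesis \<open>cont\<close> is continuity of \<open>f\<close> for the product topology on Baire space.\<close>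

locale divergence_reduction =
  fixes f :: "(nat \<Rightarrow> nat) \<Rightarrow> 'a::topological_space" and K :: "'a set"
  assumes cont: "\<And>n U. open U \<Longrightarrow> f n \<in> U \<Longrightarrow> \<exists>L. \<forall>m. (\<forall>i<L. m i = n i) \<longrightarrow> f m \<in> U"
    and mem_iff: "\<And>n. f n \<in> K \<longleftrightarrow> filterlim n at_top sequentially"
begin

text \<open>A prefix continued by the constant \<open>k\<close> does not diverge, so it misses the \<open>k\<close>-th closed set,
  and a finite prefix already witnesses this. Iterating with growing \<open>k\<close> yields a divergent
  sequence outside the union.\<close>

lemma not_fsigma: "\<not> fsigma K"
proof
  assume "fsigma K"
  then obtain F where F: "\<And>k::nat. closed (F k)" and K: "K = (\<Union>k. F k)"
    by (auto elim: fsigma.cases)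
  define P where "P k l n' l' \<longleftrightarrow> (\<forall>i. l \<le> i \<and> i < l' \<longrightarrow> k \<le> n' i) \<and>
     (\<forall>m. (\<forall>i<l'. m i = n' i) \<longrightarrow> f m \<notin> F k)" for k l and n' :: "nat \<Rightarrow> nat" and l' :: nat
  have step: "\<exists>n' l'. l < l' \<and> (\<forall>i<l. n' i = n i) \<and> P k l n' l'" for k l and n :: "nat \<Rightarrow> nat"
  proof -
    define n' where "n' i = (if i < l then n i else k)" for i
    have "\<not> filterlim n' at_top sequentially"
    proof
      assume "filterlim n' at_top sequentially"
      then have "\<forall>\<^sub>F i in sequentially. Suc k \<le> n' i \<and> l \<le> i"
        by (intro eventually_conj eventually_ge_at_top) (auto simp: filterlim_at_top)
      then obtain i where "Suc k \<le> n' i" "l \<le> i"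
        by (auto dest: eventually_happens)
      then show False
        by (simp add: n'_def)
    qed
    then have "f n' \<in> - F k"
      using mem_iff K by auto
    then obtain L where "\<And>m. (\<forall>i<L. m i = n' i) \<Longrightarrow> f m \<in> - F k"
      using cont[of "- F k" n'] F by auto
    then have "P k l n' (max (Suc l) L)"
      by (auto simp: P_def n'_def)
    then show ?thesis
      by (intro exI[of _ n'] exI[of _ "max (Suc l) L"]) (auto simp: n'_def)
  qed
  obtain m N L where L: "\<And>k. L k < L (Suc k)" and m: "\<And>k i. i < L k \<Longrightarrow> m i = N k i"
    and P: "\<And>k. P k (L k) (N (Suc k)) (L (Suc k))"
    using fusion[of P] step by metis
  have L_ge: "k \<le> L k" for k
    using strict_mono_imp_increasing[of L k] L by (simp add: strict_mono_Suc_iff)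
  have "filterlim m at_top sequentially"
    unfolding filterlim_at_top
  proof
    fix Z
    have "Z \<le> m i" if i: "L Z \<le> i" for i
    proof -
      obtain k where "Z \<le> k" "L k \<le> i" "i < L (Suc k)"
        using between_steps[of L, OF L_ge i] by auto
      then show ?thesis
        using P[of k] m[of i "Suc k"] by (auto simp: P_def)
    qed
    then show "\<forall>\<^sub>F i in sequentially. Z \<le> m i"
      by (auto simp: eventually_sequentially)
  qed
  moreover have "f m \<notin> F k" for k
    using P[of k] m[of _ "Suc k"] by (auto simp: P_def)
  ultimately show False
    using mem_iff K by auto
qed

text \<open>Dually, divergent continuations enter each open set at a finite prefix, after which a 0 can
  be inserted.\<close>

lemma not_gdelta: "\<not> gdelta K"
proof
  assume "gdelta K"
  then obtain U where U: "\<And>k::nat. open (U k)" and K: "K = (\<Inter>k. U k)"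
    by (auto elim: gdelta.cases)
  define P where "P k l n' l' \<longleftrightarrow> (\<exists>i. l \<le> i \<and> i < l' \<and> n' i = 0) \<and>
     (\<forall>m. (\<forall>i<l'. m i = n' i) \<longrightarrow> f m \<in> U k)" for k l and n' :: "nat \<Rightarrow> nat" and l' :: nat
  have step: "\<exists>n' l'. l < l' \<and> (\<forall>i<l. n' i = n i) \<and> P k l n' l'" for k l and n :: "nat \<Rightarrow> nat"
  proof -
    define n' where "n' i = (if i < l then n i else if i = l then 0 else i)" for i
    have "filterlim n' at_top sequentially"
      by (subst filterlim_cong[OF refl refl, of _ id])
        (auto simp: n'_def filterlim_ident id_def intro!: eventually_sequentiallyI[of "Suc l"])
    then have "f n' \<in> U k"
      using mem_iff K by auto
    then obtain L where "\<And>m. (\<forall>i<L. m i = n' i) \<Longrightarrow> f m \<in> U k"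
      using cont[of "U k" n'] U by auto
    then have "P k l n' (max (Suc l) L)"
      unfolding P_def by (intro conjI exI[of _ l]) (auto simp: n'_def)
    then show ?thesis
      by (intro exI[of _ n'] exI[of _ "max (Suc l) L"]) (auto simp: n'_def)
  qed
  obtain m N L where L: "\<And>k. L k < L (Suc k)" and m: "\<And>k i. i < L k \<Longrightarrow> m i = N k i"
    and P: "\<And>k. P k (L k) (N (Suc k)) (L (Suc k))"
    using fusion[of P] step by metis
  have "f m \<in> U k" for k
    using P[of k] m[of _ "Suc k"] by (auto simp: P_def)
  then have "filterlim m at_top sequentially"
    using mem_iff K by auto
  then obtain B where B: "\<And>i. B \<le> i \<Longrightarrow> Suc 0 \<le> m i"
    by (auto simp: filterlim_at_top eventually_sequentially)
  \<comment> \<open>Stage \<open>B\<close> put its 0 at a position at least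
    \<open>L B \<ge> B\<close>, where divergence already forbids zeros.\<close>
  obtain i where "L B \<le> i" "i < L (Suc B)" "N (Suc B) i = 0"
    using P[of B] by (auto simp: P_def)
  moreover have "B \<le> L B"
    using strict_mono_imp_increasing[of L B] L by (simp add: strict_mono_Suc_iff)
  ultimately show False
    using B[of i] m[of i "Suc B"] by auto
qed

end

section \<open>The Borel class of the fibres\<close>

lemma fsigma_delta_Inter:
  fixes C :: "'a::topological_space set set"
  assumes "countable C" "C \<noteq> {}" "\<And>S. S \<in> C \<Longrightarrow> fsigma S"
  shows "fsigma_delta (\<Inter>C)"
  unfolding fsigma_delta_def
  using assms by (intro exI[of _ "from_nat_into C"]) (simp add: range_from_nat_into from_nat_into)

lemma open_imp_fsigma:
  fixes S :: "'a::euclidean_space set"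
  assumes "open S" shows "fsigma S"
proof -
  obtain F where "\<And>n::nat. compact (F n)" "\<Union>(range F) = S"
    using open_Union_compact_subsets[OF assms] by metis
  then show ?thesis
    using fsigma.intros[of F] compact_imp_closed by auto
qed

text \<open>Bounding denominators from below, instead of counting values, expresses infinitude as
  membership in countably many open sets.\<close>

definition well_approx :: "real \<Rightarrow> nat \<Rightarrow> real set" where
  "well_approx c N = (\<Union>p::int. \<Union>q\<in>{max 1 N..}. {x. \<bar>x - of_int p / of_nat q\<bar> < 1 / (c * (of_nat q)\<^sup>2)})"

lemma open_well_approx: "open (well_approx c N)"
  unfolding well_approx_def by (intro open_UN ballI open_Collect_less continuous_intros)

text \<open>For each \<open>q\<close> the numerators lie within \<open>1 / \<bar>c\<bar>\<close> of
  \<open>x * q\<close>, so there are finitely many.\<close>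

lemma approx_solutions_bounded_denom_finite:
  fixes x c :: real
  shows "finite {real_of_int p / of_nat q | (p :: int) (q :: nat). 0 < q \<and> q < N \<and> \<bar>x - of_int p / of_nat q\<bar> < 1 / (c * (of_nat q)\<^sup>2)}"
   (is "finite ?S")
proof -
  have "?S \<subseteq> (\<Union>q<N. (\<lambda>p. real_of_int p / of_nat q) ` {p::int. \<bar>x * of_nat q - of_int p\<bar> \<le> 1 / \<bar>c\<bar>})"
  proof
    fix r assume "r \<in> ?S"
    then obtain p :: int and q :: nat where pq: "r = of_int p / of_nat q" "0 < q" "q < N"
      "\<bar>x - of_int p / of_nat q\<bar> < 1 / (c * (of_nat q)\<^sup>2)" by auto
    \<comment> \<open>Positivity of \<open>c\<close> comes from the solution itself: the right side
      exceeds an absolute value.\<close>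
    have "0 < 1 / (c * (real q)\<^sup>2)"
      using pq(4) abs_ge_zero[of "x - of_int p / of_nat q"] by linarith
    then have "c > 0"
      using pq(2) by (simp add: zero_less_mult_iff)
    have "\<bar>x * of_nat q - of_int p\<bar> = q * \<bar>x - of_int p / of_nat q\<bar>"
      using pq(2) by (simp add: field_simps flip: abs_mult_pos)
    also have "\<dots> \<le> q * (1 / (c * (of_nat q)\<^sup>2))"
      using pq(4) by (intro mult_left_mono) auto
    also have "\<dots> = (1 / c) * (1 / q)"
      using pq(2) by (simp add: power2_eq_square)
    also have "\<dots> \<le> (1 / c) * 1"
      using pq(2) \<open>c > 0\<close> by (intro mult_left_mono) auto
    finally show "r \<in> (\<Union>q<N. (\<lambda>p. real_of_int p / of_nat q) ` {p::int. \<bar>x * of_nat q - of_int p\<bar> \<le> 1 / \<bar>c\<bar>})"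
      using pq \<open>c > 0\<close> by auto
  qed
  moreover have "finite {p::int. \<bar>y - of_int p\<bar> \<le> b}" for y b :: real
  proof (rule finite_subset)
    show "{p::int. \<bar>y - of_int p\<bar> \<le> b} \<subseteq> {\<lceil>y - b\<rceil>..\<lfloor>y + b\<rfloor>}"
      by (auto simp: ceiling_le_iff le_floor_iff abs_le_iff)
  qed simp
  ultimately show ?thesis
    by (auto elim: finite_subset)
qed

text \<open>Bounded denominators allow only finitely many values. Conversely, finitely many
  rationals keep a positive distance from the irrational \<open>x\<close>, which solutions with
  large denominators undercut.\<close>

lemma infinite_approx_solutions_iff:
  assumes "x \<notin> \<rat>" "c > 0"
  shows "infinite (approx_solutions c x) \<longleftrightarrow> (\<forall>N. x \<in> well_approx c N)"
proof (intro iffI allI)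
  fix N assume inf: "infinite (approx_solutions c x)"
  show "x \<in> well_approx c N"
  proof (rule ccontr)
    assume neg: "x \<notin> well_approx c N"
    have "approx_solutions c x \<subseteq> {of_int p / of_nat q | (p :: int) (q :: nat). 0 < q \<and> q < N \<and> \<bar>x - of_int p / of_nat q\<bar> < 1 / (c * (of_nat q)\<^sup>2)}"
    proof
      fix r assume "r \<in> approx_solutions c x"
      then obtain p :: int and q :: nat where pq: "r = of_int p / of_nat q" "0 < q"
        "\<bar>x - of_int p / of_nat q\<bar> < 1 / (c * (of_nat q)\<^sup>2)" by (auto simp: approx_solutions_def)
      then have "q < N"
        using neg by (force simp: well_approx_def)
      with pq show "r \<in> {of_int p / of_nat q | (p :: int) (q :: nat). 0 < q \<and> q < N \<and> \<bar>x - of_int p / of_nat q\<bar> < 1 / (c * (of_nat q)\<^sup>2)}"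
        by blast
    qed
    with inf show False
      using finite_subset approx_solutions_bounded_denom_finite by blast
  qed
next
  assume all: "\<forall>N. x \<in> well_approx c N"
  show "infinite (approx_solutions c x)"
  proof
    assume fin: "finite (approx_solutions c x)"
    \<comment> \<open>The inserted 1 keeps the minimum meaningful when there are no
      solutions.\<close>
    define d where "d = Min (insert 1 ((\<lambda>r. \<bar>x - r\<bar>) ` approx_solutions c x))"
    have "r \<in> \<rat>" if "r \<in> approx_solutions c x" for r
      using that by (auto simp: approx_solutions_def)
    then have "d > 0"
      unfolding d_def using fin assms(1) by auto
    obtain N :: nat where N: "N > 1 / (c * d)"
      using reals_Archimedean2 by blast
    obtain p :: int and q :: nat where q: "q \<ge> max 1 N"
      and pq: "\<bar>x - of_int p / of_nat q\<bar> < 1 / (c * (of_nat q)\<^sup>2)"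
      using all by (fastforce simp: well_approx_def)
    have sol: "of_int p / of_nat q \<in> approx_solutions c x"
      unfolding approx_solutions_def using q pq by force
    have "d \<le> \<bar>x - of_int p / of_nat q\<bar>"
      unfolding d_def using fin sol by (intro Min_le) auto
    with pq have "d < 1 / (c * (of_nat q)\<^sup>2)"
      by simp
    also have "\<dots> \<le> 1 / (c * of_nat q)"
      using q assms(2) by (intro divide_left_mono mult_left_mono) (auto simp: power2_eq_square)
    finally have "q < 1 / (c * d)"
      using \<open>d > 0\<close> assms(2) q by (simp add: field_simps)
    with N q show False
      by simp
  qed
qed

lemma well_approx_antimono:
  assumes "0 < c" "c \<le> d" shows "well_approx d N \<subseteq> well_approx c N"
proof -
  have "1 / (d * (real q)\<^sup>2) \<le> 1 / (c * (real q)\<^sup>2)" if "q \<ge> 1" for q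
    using that assms by (intro divide_left_mono mult_right_mono) auto
  then show ?thesis
    unfolding well_approx_def by (force intro: order.strict_trans2)
qed

lemma approx_const_ge:
  assumes "x \<notin> \<rat>" "0 < c" "\<And>N. x \<in> well_approx c N"
  shows "ereal c \<le> approx_const x"
  unfolding approx_const_def using assms infinite_approx_solutions_iff[of x c]
  by (intro Sup_upper) auto

lemma well_approx_of_less:
  assumes "x \<notin> \<rat>" "0 < c" "ereal c < approx_const x"
  shows "x \<in> well_approx c N"
proof -
  obtain d where "c < d" "infinite (approx_solutions d x)"
    using assms(3) by (auto simp: approx_const_def less_Sup_iff)
  then show ?thesis
    using infinite_approx_solutions_iff[of x d] well_approx_antimono[of c d N] assms by auto
qed

text \<open>Density lets rational constants decide, which keeps the conditions countable. The
  constant \<open>t\<close> itself is avoided on both sides, because the supremum may or may not be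
  attained.\<close>

lemma approx_const_eq_iff:
  assumes "x \<notin> \<rat>" "0 < t"
  shows "approx_const x = ereal t \<longleftrightarrow>
    (\<forall>c\<in>\<rat>. 0 < c \<and> c < t \<longrightarrow> (\<forall>N. x \<in> well_approx c N)) \<and>
    (\<forall>c\<in>\<rat>. t < c \<longrightarrow> \<not> (\<forall>N. x \<in> well_approx c N))" (is "_ \<longleftrightarrow> ?A \<and> ?B")
proof (intro iffI conjI)
  assume eq: "approx_const x = ereal t"
  show ?A
    using well_approx_of_less[OF assms(1)] eq by auto
  show ?B
    using approx_const_ge[OF assms(1)] eq assms(2) by (metis ereal_less_eq(3) not_le order.strict_trans)
next
  assume AB: "?A \<and> ?B"
  show "approx_const x = ereal t"
  proof (rule antisym)
    show "approx_const x \<le> ereal t"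
    proof (rule ccontr)
      assume "\<not> approx_const x \<le> ereal t"
      then obtain u where "ereal t < ereal u" "ereal u < approx_const x"
        using ereal_dense2[of "ereal t" "approx_const x"] by (auto simp: not_le)
      moreover then obtain c where "c \<in> \<rat>" "t < c" "c < u"
        using Rats_dense_in_real[of t u] by auto
      ultimately show False
        using AB well_approx_of_less[OF assms(1), of c] assms(2) order.strict_trans[of "ereal c" "ereal u"] by auto
    qed
    show "ereal t \<le> approx_const x"
    proof (rule ccontr)
      assume neg: "\<not> ereal t \<le> approx_const x"
      then have "max (approx_const x) (ereal 0) < ereal t"
        using assms(2) by auto
      then obtain u where "max (approx_const x) (ereal 0) < ereal u" "ereal u < ereal t"
        using ereal_dense2 by blast
      moreover then obtain c where "c \<in> \<rat>" "u < c" "c < t"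
        using Rats_dense_in_real[of u t] by auto
      ultimately show False
        using AB approx_const_ge[OF assms(1), of c] order.strict_trans2[of _ "ereal u" "ereal c"]
        by (auto simp: not_le dest: order.strict_trans2 less_le_trans)
    qed
  qed
qed

lemma fsigma_delta_approx_const_fiber:
  assumes "0 < t" shows "fsigma_delta (approx_const_fiber (ereal t))"
proof -
  \<comment> \<open>The three families express irrationality, the lower bound and the upper bound.
    The first two consist of open sets, the third of complements of \<open>gdelta\<close>
    sets.\<close>
  define C where "C = (\<lambda>r. - {r}) ` \<rat> \<union> (\<lambda>(c, N). well_approx c N) ` ({c \<in> \<rat>. 0 < c \<and> c < t} \<times> UNIV)
    \<union> (\<lambda>c. - (\<Inter>N. well_approx c N)) ` {c \<in> \<rat>. t < c}"
  have C: "x \<in> \<Inter>C \<longleftrightarrow> x \<notin> \<rat> \<and>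
    (\<forall>c\<in>\<rat>. 0 < c \<and> c < t \<longrightarrow> (\<forall>N. x \<in> well_approx c N)) \<and>
    (\<forall>c\<in>\<rat>. t < c \<longrightarrow> \<not> (\<forall>N. x \<in> well_approx c N))" for x
    unfolding C_def by (auto simp: ball_Un)
  have "approx_const_fiber (ereal t) = \<Inter>C"
    unfolding set_eq_iff C approx_const_fiber_def mem_Collect_eq
    using approx_const_eq_iff[OF _ assms] by blast
  moreover have "fsigma_delta (\<Inter>C)"
  proof (rule fsigma_delta_Inter)
    show "countable C"
      unfolding C_def by (intro countable_Un countable_image countable_SIGMA
          countable_Collect countable_rat) auto
    show "C \<noteq> {}"
      unfolding C_def using Rats_0 by blast
    have "gdelta (\<Inter>N. well_approx c N)" for c
      by (intro gdelta.intros open_well_approx)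
    then show "fsigma S" if "S \<in> C" for S
      using that unfolding C_def
      by (auto simp del: Compl_INT intro: open_imp_fsigma open_well_approx gdelta_imp_fsigma)
  qed
  ultimately show ?thesis
    by simp
qed

section \<open>Continued fractions with partial quotients 1 and 2\<close>

text \<open>For \<open>n > 0\<close> this is the finite continued fraction
  \<open>[0; a_k, ..., a_(k+n-1) + t]\<close>.\<close>

fun cf_map :: "(nat \<Rightarrow> nat) \<Rightarrow> nat \<Rightarrow> nat \<Rightarrow> real \<Rightarrow> real" where
  "cf_map a k 0 t = t"
| "cf_map a k (Suc n) t = 1 / (real (a k) + cf_map a (Suc k) n t)"

lemma cf_map_add: "cf_map a k (m + n) t = cf_map a k m (cf_map a (k + m) n t)"
  by (induction m arbitrary: k) auto

lemma cf_map_cong: "(\<And>i. i < k + n \<Longrightarrow> a i = b i) \<Longrightarrow> cf_map a k n t = cf_map b k n t"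
  by (induction n arbitrary: k) auto

lemma inverse_add_mem:
  fixes d :: nat and t :: real
  assumes "d \<in> {1, 2}" "t \<in> {1/3..1}"
  shows "1 / (real d + t) \<in> {1/3..1}"
  using assms by (auto simp: field_simps)

text \<open>Both denominators are at least 4/3, and 9/16 is the square of 3/4.\<close>

lemma inverse_add_contraction:
  fixes d :: nat and s t :: real
  assumes "d \<in> {1, 2}" "s \<in> {1/3..1}" "t \<in> {1/3..1}"
  shows "\<bar>1 / (real d + s) - 1 / (real d + t)\<bar> \<le> 9/16 * \<bar>s - t\<bar>"
proof -
  have pos: "real d + s \<ge> 4/3" "real d + t \<ge> 4/3"
    using assms by auto
  then have "4/3 * (4/3) \<le> (real d + s) * (real d + t)"
    by (intro mult_mono) auto
  moreover have "\<bar>1 / (real d + s) - 1 / (real d + t)\<bar> = \<bar>s - t\<bar> / ((real d + s) * (real d + t))"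
    using pos by (simp add: diff_frac_eq abs_mult abs_minus_commute)
  ultimately show ?thesis
    using divide_left_mono[of "16/9" "(real d + s) * (real d + t)" "\<bar>s - t\<bar>"] by (simp add: mult_pos_pos)
qed

text \<open>The infinite continued fraction \<open>[0; a_k, a_(k+1), ...]\<close>; the seed 1 is
  just a point of the invariant interval from 1/3 to 1.\<close>

definition cf_tail :: "(nat \<Rightarrow> nat) \<Rightarrow> nat \<Rightarrow> real" where
  "cf_tail a k = lim (\<lambda>n. cf_map a k n 1)"

text \<open>The \<open>n\<close>-th convergent is \<open>cf_num a (n + 1) / cf_den a (n + 1)\<close>; the index 0 holds the
  formal convergent \<open>1/0\<close>.\<close>

fun cf_num :: "(nat \<Rightarrow> nat) \<Rightarrow> nat \<Rightarrow> int" where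
  "cf_num a 0 = 1"
| "cf_num a (Suc 0) = 0"
| "cf_num a (Suc (Suc n)) = int (a n) * cf_num a (Suc n) + cf_num a n"

fun cf_den :: "(nat \<Rightarrow> nat) \<Rightarrow> nat \<Rightarrow> int" where
  "cf_den a 0 = 0"
| "cf_den a (Suc 0) = 1"
| "cf_den a (Suc (Suc n)) = int (a n) * cf_den a (Suc n) + cf_den a n"

lemma cf_det: "cf_den a (Suc n) * cf_num a n - cf_num a (Suc n) * cf_den a n = (-1) ^ n"
  by (induction n) (simp_all add: algebra_simps)

text \<open>A ratio of successive denominators is the reversed continued fraction
  \<open>[0; a_(n-1), ..., a_0]\<close>, see \<open>head_Suc\<close>.\<close>

definition cf_head :: "(nat \<Rightarrow> nat) \<Rightarrow> nat \<Rightarrow> real" where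
  "cf_head a n = real_of_int (cf_den a n) / real_of_int (cf_den a (Suc n))"

definition cf_val :: "(nat \<Rightarrow> nat) \<Rightarrow> nat \<Rightarrow> real" where
  "cf_val a n = real (a n) + cf_tail a (Suc n) + cf_head a n"

locale one_two_cf =
  fixes a :: "nat \<Rightarrow> nat"
  assumes digit: "a i \<in> {1, 2}"
begin

lemma map_mem:
  assumes "t \<in> {1/3..1}"
  shows "cf_map a k n t \<in> {1/3..1}"
  using assms inverse_add_mem[OF digit] by (induction n arbitrary: k) (simp_all del: atLeastAtMost_iff)

lemma map_contraction:
  assumes "s \<in> {1/3..1}" "t \<in> {1/3..1}"
  shows "\<bar>cf_map a k n s - cf_map a k n t\<bar> \<le> (9/16) ^ n"
proof (induction n arbitrary: k)
  case 0
  then show ?case using assms by (auto simp: abs_le_iff)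
next
  case (Suc n)
  show ?case
    using inverse_add_contraction[OF digit[of k] map_mem[OF assms(1), of "Suc k" n] map_mem[OF assms(2), of "Suc k" n]]
      Suc[of "Suc k"] by simp
qed

lemma tail_tendsto: "(\<lambda>n. cf_map a k n 1) \<longlonglongrightarrow> cf_tail a k"
proof -
  \<comment> \<open>Digits beyond the first \<open>N\<close> change only the innermost argument of a
    depth \<open>N\<close> map.\<close>
  have close: "dist (cf_map a k m 1) (cf_map a k N 1) \<le> (9/16) ^ N" if "N \<le> m" for m N
    using map_contraction[OF map_mem, of 1 1 k N "k + N" "m - N"] that cf_map_add[of a k N "m - N" 1]
    by (simp add: dist_real_def)
  have "Cauchy (\<lambda>n. cf_map a k n 1)"
  proof (rule metric_CauchyI)
    fix e :: real assume "0 < e"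
    then obtain N where N: "(9/16) ^ N < e / 2"
      using real_arch_pow_inv[of "e/2" "9/16"] by auto
    have "dist (cf_map a k m 1) (cf_map a k n 1) < e" if "N \<le> m" "N \<le> n" for m n
      using close[OF that(1)] close[OF that(2)] N dist_triangle2[of "cf_map a k m 1" "cf_map a k n 1" "cf_map a k N 1"]
      by linarith
    then show "\<exists>M. \<forall>m\<ge>M. \<forall>n\<ge>M. dist (cf_map a k m 1) (cf_map a k n 1) < e"
      by blast
  qed
  then show ?thesis
    unfolding cf_tail_def by (simp add: Cauchy_convergent_iff convergent_LIMSEQ_iff)
qed

lemma tail_mem: "cf_tail a k \<in> {1/3..1}"
  by (rule closed_sequentially[OF closed_atLeastAtMost _ tail_tendsto]) (rule map_mem, simp)

lemma tail_unfold: "cf_tail a k = 1 / (real (a k) + cf_tail a (Suc k))"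
proof (rule LIMSEQ_unique)
  show "(\<lambda>n. cf_map a k (Suc n) 1) \<longlonglongrightarrow> cf_tail a k"
    using tail_tendsto by (rule LIMSEQ_Suc)
  have "real (a k) + cf_tail a (Suc k) \<noteq> 0"
    using tail_mem[of "Suc k"] by auto
  then have "(\<lambda>n. 1 / (real (a k) + cf_map a (Suc k) n 1)) \<longlonglongrightarrow> 1 / (real (a k) + cf_tail a (Suc k))"
    by (intro tendsto_intros tail_tendsto)
  then show "(\<lambda>n. cf_map a k (Suc n) 1) \<longlonglongrightarrow> 1 / (real (a k) + cf_tail a (Suc k))"
    by simp
qed

lemma tail_eq_map: "cf_tail a k = cf_map a k n (cf_tail a (k + n))"
proof (induction n arbitrary: k)
  case (Suc n)
  show ?case
    using tail_unfold[of k] Suc[of "Suc k"] by simp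
qed simp

section \<open>Denominators and errors of the convergents\<close>

lemma digit_ge: "int (a i) \<ge> 1"
  using digit[of i] by auto

lemma den_pos: "cf_den a n \<ge> 0 \<and> cf_den a (Suc n) \<ge> 1"
proof (induction n)
  case (Suc n)
  have "1 * 1 \<le> int (a n) * cf_den a (Suc n)"
    using Suc digit_ge by (intro mult_mono) auto
  with Suc show ?case by simp
qed simp

lemma den_step: "cf_den a (Suc n) + cf_den a n \<le> cf_den a (Suc (Suc n))"
  using mult_right_mono[OF digit_ge, of "cf_den a (Suc n)" n] den_pos[of n] by simp

lemma den_le_Suc: "cf_den a n \<le> cf_den a (Suc n)"
proof (cases n)
  case (Suc m)
  then show ?thesis
    using den_step[of m] den_pos[of m] by (simp del: cf_den.simps(3))
qed simp

lemma den_mono: "m \<le> n \<Longrightarrow> cf_den a m \<le> cf_den a n"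
  using lift_Suc_mono_le[of "cf_den a"] den_le_Suc by blast

lemma den_ge: "int n \<le> cf_den a (Suc n)"
proof (induction n)
  case (Suc n)
  show ?case
  proof (cases n)
    case 0
    then show ?thesis
      using den_pos[of "Suc 0"] by simp
  next
    case (Suc m)
    then have "1 \<le> cf_den a n"
      using den_pos[of m] by simp
    then show ?thesis
      using den_step[of n] \<open>int n \<le> cf_den a (Suc n)\<close> by linarith
  qed
qed simp

definition err :: "nat \<Rightarrow> real" where
  "err n = cf_den a n * cf_tail a 0 - cf_num a n"

lemma tail_mult: "cf_tail a n * (real (a n) + cf_tail a (Suc n)) = 1"
proof -
  have "real (a n) + cf_tail a (Suc n) > 0"
    using tail_mem[of "Suc n"] by auto
  then show ?thesis
    by (subst tail_unfold) simp
qed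

text \<open>The two forms are equivalent by \<open>tail_mult\<close>, and the induction needs both:
  the second turns the recursion \<open>a n * err (Suc n) + err n\<close> into a multiple of
  \<open>err (Suc n)\<close>.\<close>

lemma err_Suc: "err (Suc n) = - cf_tail a n * err n"
  and err_eq: "err n = - (real (a n) + cf_tail a (Suc n)) * err (Suc n)"
proof -
  have step: "err n = - (real (a n) + cf_tail a (Suc n)) * err (Suc n)"
    if "err (Suc n) = - cf_tail a n * err n" for n
  proof -
    have "- (real (a n) + cf_tail a (Suc n)) * err (Suc n)
        = (cf_tail a n * (real (a n) + cf_tail a (Suc n))) * err n"
      unfolding that by (simp only: mult_minus_left mult_minus_right minus_minus mult_ac)
    then show ?thesis
      unfolding tail_mult by simp
  qed
  show Suc: "err (Suc n) = - cf_tail a n * err n"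
  proof (induction n)
    case (Suc n)
    have "err (Suc (Suc n)) = a n * err (Suc n) + err n"
      by (simp add: err_def algebra_simps)
    with step[OF Suc] show ?case
      by (simp add: algebra_simps)
  qed (simp add: err_def)
  show "err n = - (real (a n) + cf_tail a (Suc n)) * err (Suc n)"
    by (rule step) (rule Suc)
qed

lemma head_Suc: "cf_head a (Suc n) = 1 / (real (a n) + cf_head a n)"
  using den_pos[of n] by (simp add: cf_head_def field_simps)

lemma head_mem: "cf_head a n \<in> {0..1}"
  using den_mono[of n "Suc n"] den_pos[of n] by (simp add: cf_head_def)

lemma val_gt_1: "cf_val a n > 1"
  using digit_ge[of n] tail_mem[of "Suc n"] head_mem[of n] by (auto simp: cf_val_def)

text \<open>The determinant identity \<open>cf_det\<close>, written in errors, with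
  \<open>err n\<close> eliminated by \<open>err_eq\<close>. It makes \<open>cf_val a n\<close> the
  exact constant with which the convergent approximates.\<close>

lemma err_mult_val: "\<bar>err (Suc n)\<bar> * (cf_den a (Suc n) * cf_val a n) = 1"
proof -
  have "cf_den a (Suc n) * err n - cf_den a n * err (Suc n) =
     - real_of_int (cf_den a (Suc n) * cf_num a n - cf_num a (Suc n) * cf_den a n)"
    by (simp add: err_def algebra_simps)
  also have "\<dots> = - ((-1) ^ n)"
    unfolding cf_det by simp
  finally have "err (Suc n) * (cf_den a (Suc n) * (real (a n) + cf_tail a (Suc n)) + cf_den a n) = (-1) ^ n"
    unfolding err_eq[of n] by (simp add: algebra_simps)
  moreover have "cf_den a (Suc n) * cf_val a n =
      cf_den a (Suc n) * (real (a n) + cf_tail a (Suc n)) + cf_den a n"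
    using den_pos[of n] by (simp add: cf_val_def cf_head_def field_simps)
  ultimately have eq: "err (Suc n) * (cf_den a (Suc n) * cf_val a n) = (-1) ^ n"
    by simp
  have "cf_den a (Suc n) * cf_val a n \<ge> 0"
    using den_pos[of n] val_gt_1[of n] by (intro mult_nonneg_nonneg) auto
  then have "\<bar>err (Suc n)\<bar> * (cf_den a (Suc n) * cf_val a n) = \<bar>err (Suc n) * (cf_den a (Suc n) * cf_val a n)\<bar>"
    by (rule abs_mult_pos)
  then show ?thesis
    unfolding eq by (simp add: power_abs)
qed

lemma dist_convergent:
  "\<bar>cf_tail a 0 - cf_num a (Suc n) / cf_den a (Suc n)\<bar> = 1 / (cf_val a n * (real_of_int (cf_den a (Suc n)))\<^sup>2)"
proof -
  have pos: "real_of_int (cf_den a (Suc n)) > 0" "cf_val a n > 0"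
    using den_pos[of n] val_gt_1[of n] by auto
  have "cf_tail a 0 - cf_num a (Suc n) / cf_den a (Suc n) = err (Suc n) / cf_den a (Suc n)"
    using pos by (simp add: err_def field_simps)
  then have "\<bar>cf_tail a 0 - cf_num a (Suc n) / cf_den a (Suc n)\<bar> = \<bar>err (Suc n)\<bar> / cf_den a (Suc n)"
    using pos by simp
  also have "\<dots> = 1 / (cf_val a n * (real_of_int (cf_den a (Suc n)))\<^sup>2)"
    using err_mult_val[of n] pos by (simp add: field_simps power2_eq_square)
  finally show ?thesis .
qed

text \<open>For a fraction with denominator \<open>s\<close>, \<open>s\<close> times an error would
  be a nonzero integer, yet it is below 1 once the denominator of the convergent reaches
  \<open>s\<close>.\<close>

lemma irrational: "cf_tail a 0 \<notin> \<rat>"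
proof
  assume "cf_tail a 0 \<in> \<rat>"
  then obtain r s :: int where s: "s > 0" and x: "cf_tail a 0 = r / s"
    by (elim Rats_cases') auto
  define n where "n = nat s"
  define X where "X = cf_den a (Suc n) * r - cf_num a (Suc n) * s"
  have "real_of_int s * err (Suc n) = real_of_int X"
    using s by (simp add: err_def x X_def field_simps)
  then have X: "real_of_int s * \<bar>err (Suc n)\<bar> = \<bar>real_of_int X\<bar>"
    using s by (metis abs_mult abs_of_pos of_int_0_less_iff)
  have ne: "err (Suc n) \<noteq> 0"
    using err_mult_val[of n] by auto
  then have "X \<noteq> 0"
    using s X by auto
  then have ge: "1 \<le> real_of_int s * \<bar>err (Suc n)\<bar>"
    unfolding X by linarith
  have "real_of_int s * \<bar>err (Suc n)\<bar> \<le> cf_den a (Suc n) * \<bar>err (Suc n)\<bar>"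
    using den_ge[of n] s by (intro mult_right_mono) (auto simp: n_def)
  also have "\<dots> < cf_den a (Suc n) * \<bar>err (Suc n)\<bar> * cf_val a n"
    using den_pos[of n] ne val_gt_1[of n] by simp
  also have "\<dots> = 1"
    using err_mult_val[of n] by (simp add: mult_ac)
  finally show False
    using ge by simp
qed

text \<open>Legendre's theorem, via the law of best approximation: writing \<open>(p, q)\<close> as an integer
  combination of two successive convergents, the coefficients have opposite signs.\<close>

lemma legendre:
  fixes p q :: int
  assumes q: "cf_den a (Suc n) \<le> q" "q < cf_den a (Suc (Suc n))"
    and close: "\<bar>q * cf_tail a 0 - p\<bar> < 1 / (2 * q)"
  shows "p * cf_den a (Suc n) = q * cf_num a (Suc n)"
proof (rule ccontr)
  assume ne: "p * cf_den a (Suc n) \<noteq> q * cf_num a (Suc n)"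
  define q1 p1 q2 p2 where "q1 = cf_den a (Suc n)" and "p1 = cf_num a (Suc n)"
    and "q2 = cf_den a (Suc (Suc n))" and "p2 = cf_num a (Suc (Suc n))"
  define e :: int where "e = (-1) ^ Suc n"
  have e: "e * e = 1" and det: "q2 * p1 - p2 * q1 = e"
    using cf_det[of a "Suc n"] by (simp_all add: e_def q1_def p1_def q2_def p2_def flip: power_mult_distrib)
  \<comment> \<open>Cramer's rule; the determinant \<open>e\<close> is its own inverse.\<close>
  define u v where "u = - e * (q * p2 - p * q2)" and "v = - e * (p * q1 - q * p1)"
  have "u * q1 + v * q2 = e * q * (q2 * p1 - p2 * q1)" "u * p1 + v * p2 = e * p * (q2 * p1 - p2 * q1)"
    by (simp_all add: u_def v_def algebra_simps)
  then have uv: "u * q1 + v * q2 = q" "u * p1 + v * p2 = p"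
    unfolding det using e by (simp_all add: mult.commute mult.left_commute)
  have "v \<noteq> 0"
    using ne e by (auto simp: v_def p1_def q1_def)
  have pos: "1 \<le> q1" "q1 \<le> q" "q < q2"
    using q den_pos[of n] by (auto simp: q1_def q2_def)
  have xi: "0 < cf_tail a (Suc n)"
    using tail_mem[of "Suc n"] by simp
  \<comment> \<open>As \<open>0 < q < q2\<close>, a positive \<open>v\<close> forces
    \<open>u < 0\<close> and a negative \<open>v\<close> forces \<open>u > 0\<close>, so the two
    terms cannot cancel.\<close>
  have coef: "1 \<le> \<bar>real_of_int u - v * cf_tail a (Suc n)\<bar>"
  proof (cases "v > 0")
    case True
    then have "1 * q2 \<le> v * q2"
      using pos by (intro mult_right_mono) auto
    then have "u * q1 < 0"
      using uv(1) pos by linarith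
    then have "real_of_int u \<le> -1"
      using pos by (auto simp: mult_less_0_iff)
    moreover have "0 < v * cf_tail a (Suc n)"
      using True xi by simp
    ultimately show ?thesis by linarith
  next
    case False
    then have "v * q2 < 0"
      using pos \<open>v \<noteq> 0\<close> by (intro mult_neg_pos) auto
    then have "u * q1 > 0"
      using uv(1) pos by linarith
    then have "real_of_int u \<ge> 1"
      using pos by (auto simp: zero_less_mult_iff)
    moreover have "v * cf_tail a (Suc n) < 0"
      using False xi \<open>v \<noteq> 0\<close> by (intro mult_neg_pos) auto
    ultimately show ?thesis by linarith
  qed
  define d where "d = q * cf_tail a 0 - p"
  have "d = u * err (Suc n) + v * err (Suc (Suc n))"
    unfolding d_def err_def uv[symmetric] by (simp add: q1_def p1_def q2_def p2_def algebra_simps)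
  also have "\<dots> = (u - v * cf_tail a (Suc n)) * err (Suc n)"
    unfolding err_Suc[of "Suc n"] by (simp add: algebra_simps)
  finally have "1 * \<bar>err (Suc n)\<bar> \<le> \<bar>d\<bar>"
    using mult_right_mono[OF coef, of "\<bar>err (Suc n)\<bar>"] by (simp add: abs_mult)
  \<comment> \<open>This sum bounds the integer \<open>\<bar>p * q1 - q * p1\<bar>\<close>, which
    therefore vanishes once the sum is below 1.\<close>
  then have "q * \<bar>err (Suc n)\<bar> + q1 * \<bar>d\<bar> \<le> q * \<bar>d\<bar> + q * \<bar>d\<bar>"
    using pos by (intro add_mono mult_mono) auto
  also have "\<dots> < 1"
    using close pos by (simp add: d_def field_simps)
  finally have small: "q * \<bar>err (Suc n)\<bar> + q1 * \<bar>d\<bar> < 1" .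
  have "real_of_int (p * q1 - q * p1) = q * err (Suc n) - q1 * d"
    by (simp add: err_def d_def q1_def p1_def algebra_simps)
  then have "\<bar>real_of_int (p * q1 - q * p1)\<bar> \<le> q * \<bar>err (Suc n)\<bar> + q1 * \<bar>d\<bar>"
    using pos abs_triangle_ineq4[of "q * err (Suc n)" "q1 * d"] by (simp add: abs_mult)
  then have "\<bar>p * q1 - q * p1\<bar> < 1"
    using small by linarith
  then show False
    using ne by (simp add: p1_def q1_def)
qed

end

section \<open>Dependence on the digits, and the best constant as an upper limit\<close>

lemma tail_close:
  assumes "one_two_cf a" "one_two_cf b" "\<And>i. i < n \<Longrightarrow> a i = b i"
  shows "\<bar>cf_tail a 0 - cf_tail b 0\<bar> \<le> (9/16) ^ n"
proof -
  interpret a: one_two_cf a by fact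
  interpret b: one_two_cf b by fact
  have "cf_tail a 0 = cf_map b 0 n (cf_tail a n)"
    using a.tail_eq_map[of 0 n] cf_map_cong[of 0 n a b] assms(3) by simp
  then show ?thesis
    using b.map_contraction[OF a.tail_mem b.tail_mem, of 0 n n n] b.tail_eq_map[of 0 n] by simp
qed

context one_two_cf
begin

lemma approx_const_ge_of_val:
  assumes "0 < c" and freq: "\<And>N. \<exists>n\<ge>N. c < cf_val a n"
  shows "ereal c \<le> approx_const (cf_tail a 0)"
proof (rule approx_const_ge[OF irrational \<open>0 < c\<close>])
  fix N
  obtain n where n: "N \<le> n" "c < cf_val a n"
    using freq by blast
  define q where "q = nat (cf_den a (Suc n))"
  have q: "int q = cf_den a (Suc n)" "real_of_int (cf_den a (Suc n)) = real q"
    using den_pos[of n] by (auto simp: q_def)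
  have "max 1 N \<le> q"
    using n den_ge[of n] den_pos[of n] q(1) by linarith
  moreover have "\<bar>cf_tail a 0 - cf_num a (Suc n) / real q\<bar> < 1 / (c * (real q)\<^sup>2)"
    unfolding q(2)[symmetric] dist_convergent
    using n(2) \<open>0 < c\<close> den_pos[of n] by (intro divide_strict_left_mono mult_strict_right_mono mult_pos_pos) auto
  ultimately show "cf_tail a 0 \<in> well_approx c N"
    unfolding well_approx_def by blast
qed

text \<open>A constant above 2 puts every solution within reach of Legendre's theorem, so a solution
  with large denominator equals a late convergent, whose constant is at most
  \<open>t\<close>.\<close>

lemma approx_const_le_of_val:
  assumes "2 \<le> t" and ev: "\<And>n. N \<le> n \<Longrightarrow> cf_val a n \<le> t"
  shows "approx_const (cf_tail a 0) \<le> ereal t"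
proof (rule ccontr)
  assume "\<not> approx_const (cf_tail a 0) \<le> ereal t"
  then obtain c where c: "t < c" "ereal c < approx_const (cf_tail a 0)"
    using ereal_dense2[of "ereal t"] by (auto simp: not_le)
  define L where "L n = nat (cf_den a (Suc n))" for n
  have L: "int (L n) = cf_den a (Suc n)" "real_of_int (cf_den a (Suc n)) = real (L n)" "0 < L n" for n
    using den_pos[of n] by (auto simp: L_def)
  have "cf_tail a 0 \<in> well_approx c (L N)"
    using well_approx_of_less[OF irrational _ c(2)] c(1) assms(1) by auto
  then obtain p :: int and q :: nat where q: "max 1 (L N) \<le> q"
    and pq: "\<bar>cf_tail a 0 - p / q\<bar> < 1 / (c * (real q)\<^sup>2)"
    by (auto simp: well_approx_def)
  have "n \<le> L n" for n
    using den_ge[of n] L(1)[of n] by simp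
  then obtain n where n: "N \<le> n" "L n \<le> q" "q < L (Suc n)"
    using between_steps[of L N q] q by auto
  have "\<bar>int q * cf_tail a 0 - p\<bar> = real q * \<bar>cf_tail a 0 - p / q\<bar>"
    using q by (simp add: abs_mult_pos' algebra_simps)
  also have "\<dots> < real q * (1 / (c * (real q)\<^sup>2))"
    using pq q by (intro mult_strict_left_mono) auto
  also have "\<dots> = 1 / (c * q)"
    using q by (simp add: power2_eq_square)
  also have "\<dots> \<le> 1 / (2 * q)"
    using q c(1) assms(1) by (intro divide_left_mono mult_right_mono mult_pos_pos) auto
  finally have "p * cf_den a (Suc n) = int q * cf_num a (Suc n)"
    using legendre[of n "int q" p] n(2,3) L(1)[of n] L(1)[of "Suc n"] by simp
  then have "real_of_int p * L n = q * cf_num a (Suc n)"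
    using L(2) by (metis of_int_mult of_int_of_nat_eq)
  then have "p / q = cf_num a (Suc n) / cf_den a (Suc n)"
    using q L(2,3)[of n] by (simp add: field_simps)
  \<comment> \<open>The fraction \<open>p / q\<close> may be unreduced; \<open>L n \<le> q\<close>
    makes the comparison go the right way.\<close>
  then have "1 / (cf_val a n * (real (L n))\<^sup>2) < 1 / (c * (real q)\<^sup>2)"
    using pq dist_convergent[of n] L(2) by simp
  also have "\<dots> \<le> 1 / (c * (real (L n))\<^sup>2)"
    using c(1) assms(1) n(2) L(3)[of n] by (intro divide_left_mono mult_left_mono power_mono mult_pos_pos) auto
  finally have "c < cf_val a n"
    using L(3)[of n] c(1) assms(1) val_gt_1[of n] by (simp add: field_simps)
  with ev[OF n(1)] c(1) show False
    by simp
qed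

end

section \<open>Long runs of ones\<close>

definition gold_map :: "real \<Rightarrow> real" where
  "gold_map t = 1 / (1 + t)"

definition gold :: real where
  "gold = (sqrt 5 - 1) / 2"

lemma gold_square: "gold * gold = 1 - gold"
  by (simp add: gold_def field_simps)

lemma gold_bounds: "1/2 < gold" "gold < 1"
proof -
  have "2 < sqrt 5" "sqrt 5 < 3"
    by (auto intro: real_less_rsqrt real_less_lsqrt)
  then show "1/2 < gold" "gold < 1"
    by (auto simp: gold_def)
qed

lemma gold_map_gold: "gold_map gold = gold"
  using gold_square gold_bounds by (simp add: gold_map_def field_simps)

lemma gold_map_nonneg: "0 \<le> t \<Longrightarrow> 0 \<le> gold_map t"
  by (simp add: gold_map_def)

lemma gold_map_mem: "t \<in> {0..1} \<Longrightarrow> gold_map t \<in> {0..1}"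
  by (auto simp: gold_map_def)

lemma gold_map_funpow_mem: "t \<in> {0..1} \<Longrightarrow> (gold_map ^^ n) t \<in> {0..1}"
  by (induction n) (auto simp del: atLeastAtMost_iff intro: gold_map_mem)

text \<open>Near its fixed point the map contracts by \<open>1 / ((1 + s) * (1 + gold))\<close>, and
  \<open>1 + gold\<close> exceeds 3/2.\<close>

lemma gold_map_funpow_near:
  assumes "t \<in> {0..1}"
  shows "\<bar>(gold_map ^^ n) t - gold\<bar> \<le> (2/3) ^ n"
proof (induction n)
  case 0
  then show ?case using assms gold_bounds by (auto simp: abs_le_iff)
next
  case (Suc n)
  define s where "s = (gold_map ^^ n) t"
  have s: "0 \<le> s"
    using gold_map_funpow_mem[OF assms, of n] by (simp add: s_def)
  \<comment> \<open>Only the subtracted \<open>gold\<close> is rewritten to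
    \<open>gold_map gold\<close>; rewriting every occurrence would loop.\<close>
  have "gold_map s - gold = (gold - s) / ((1 + s) * (1 + gold))"
    using s gold_bounds unfolding gold_map_gold[symmetric, THEN arg_cong[of _ _ "\<lambda>u. gold_map s - u"]]
    by (simp add: gold_map_def diff_frac_eq)
  then have "\<bar>gold_map s - gold\<bar> = \<bar>s - gold\<bar> / ((1 + s) * (1 + gold))"
    using s gold_bounds by (simp add: abs_mult abs_minus_commute)
  also have "\<dots> \<le> \<bar>s - gold\<bar> / (1 * (3/2))"
    using s gold_bounds by (intro divide_left_mono mult_mono mult_pos_pos) auto
  also have "\<dots> \<le> (2/3) ^ Suc n"
    using Suc by (simp add: s_def)
  finally show ?case
    by (simp add: s_def)
qed

lemma gold_map_antimono: "0 \<le> s \<Longrightarrow> s \<le> t \<Longrightarrow> gold_map t \<le> gold_map s"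
  by (simp add: gold_map_def frac_le)

lemma gold_map_strict_antimono: "0 \<le> s \<Longrightarrow> s < t \<Longrightarrow> gold_map t < gold_map s"
  by (simp add: gold_map_def frac_less2)

text \<open>A decreasing map has increasing even iterates. This is why the parity of a run of 1s
  decides the side of \<open>gold\<close> on which a value lands.\<close>

lemma gold_map_funpow_even_mono:
  assumes "0 \<le> s" "s \<le> t"
  shows "0 \<le> (gold_map ^^ (2 * n)) s \<and> (gold_map ^^ (2 * n)) s \<le> (gold_map ^^ (2 * n)) t"
proof (induction n)
  case (Suc n)
  define u v where "u = (gold_map ^^ (2 * n)) s" and "v = (gold_map ^^ (2 * n)) t"
  have "0 \<le> u" "u \<le> v"
    using Suc by (auto simp: u_def v_def)
  moreover then have "0 \<le> gold_map u" "0 \<le> gold_map v"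
    by (simp_all add: gold_map_nonneg)
  ultimately show ?case
    using gold_map_antimono[of u v] gold_map_antimono[of "gold_map v" "gold_map u"] gold_map_nonneg[of "gold_map u"]
    by (simp flip: u_def v_def)
qed (use assms in simp)

lemma gold_map_funpow_even_le_gold:
  assumes "0 \<le> t" "t \<le> gold"
  shows "(gold_map ^^ (2 * n)) t \<le> gold"
proof -
  have "(gold_map ^^ m) gold = gold" for m
    by (induction m) (auto simp: gold_map_gold)
  then show ?thesis
    using gold_map_funpow_even_mono[OF assms, of n] by simp
qed

lemma gold_map_funpow_odd_ge:
  assumes "0 \<le> t" "t \<le> 1/2"
  shows "(gold_map ^^ Suc (2 * n)) (1/2) \<le> (gold_map ^^ Suc (2 * n)) t"
  using gold_map_funpow_even_mono[of t "1/2" n] assms by (simp add: gold_map_antimono)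

lemma gold_map_funpow_half: "(gold_map ^^ (2 * n)) (1/2) < gold \<and> gold < (gold_map ^^ Suc (2 * n)) (1/2)"
proof (induction n)
  case 0
  then show ?case using gold_bounds gold_map_strict_antimono[of "1/2" gold] gold_map_gold by simp
next
  case (Suc n)
  define u where "u = (gold_map ^^ Suc (2 * n)) (1/2)"
  have "gold < u"
    using Suc by (simp add: u_def)
  then have "gold_map u < gold" "0 \<le> gold_map u"
    using gold_map_strict_antimono[of gold u] gold_map_gold gold_bounds gold_map_nonneg[of u]
    by simp_all
  moreover then have "gold < gold_map (gold_map u)"
    using gold_map_strict_antimono[of "gold_map u" gold] gold_map_gold by simp
  ultimately show ?case
    by (simp add: u_def)
qed

text \<open>The least excess over \<open>gold\<close> after an odd run that follows a 2, where the
  head is at most 1/2. It depends only on the run length, so a recurring block gives a fixed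
  gain.\<close>

definition odd_gap :: "nat \<Rightarrow> real" where
  "odd_gap n = (gold_map ^^ Suc (2 * n)) (1/2) - gold"

lemma odd_gap_pos: "0 < odd_gap n"
  using gold_map_funpow_half by (simp add: odd_gap_def)

lemma inverse_two_add_gold: "1 / (2 + gold) = 1 - gold"
  using gold_square gold_bounds by (simp add: field_simps)

lemma pair_value_near_three:
  assumes "0 \<le> x" "\<bar>x - gold\<bar> \<le> e" "\<bar>y - gold\<bar> \<le> e"
  shows "\<bar>2 + 1 / (2 + x) + y - 3\<bar> \<le> 2 * e"
proof -
  have "\<bar>1 / (2 + x) - 1 / (2 + gold)\<bar> = \<bar>x - gold\<bar> / ((2 + x) * (2 + gold))"
    using assms gold_bounds by (simp add: diff_frac_eq abs_mult abs_minus_commute)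
  also have "\<dots> \<le> \<bar>x - gold\<bar> / (1 * 1)"
    using assms gold_bounds by (intro divide_left_mono mult_mono mult_pos_pos) auto
  finally have "\<bar>1 / (2 + x) - 1 / (2 + gold)\<bar> \<le> e"
    using assms by simp
  then show ?thesis
    using assms(3) unfolding inverse_two_add_gold abs_le_iff by (simp add: algebra_simps)
qed

context one_two_cf
begin

lemma tail_ones:
  assumes "\<And>j. j < N \<Longrightarrow> a (k + j) = 1"
  shows "cf_tail a k = (gold_map ^^ N) (cf_tail a (k + N))"
  using assms
proof (induction N)
  case (Suc N)
  have "cf_tail a (k + N) = gold_map (cf_tail a (k + Suc N))"
    using tail_unfold[of "k + N"] Suc.prems[of N] by (simp add: gold_map_def)
  with Suc show ?case
    by (simp add: funpow_swap1)
qed simp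

lemma head_ones:
  assumes "\<And>j. j < N \<Longrightarrow> a (k + j) = 1"
  shows "cf_head a (k + N) = (gold_map ^^ N) (cf_head a k)"
  using assms
proof (induction N)
  case (Suc N)
  then show ?case
    using head_Suc[of "k + N"] by (simp add: gold_map_def)
qed simp

lemma tail_le_half:
  assumes "a k = 2" shows "cf_tail a k \<le> 1/2"
  using tail_unfold[of k] tail_mem[of "Suc k"] assms frac_le[of 1 1 2 "2 + cf_tail a (Suc k)"] by simp

lemma head_le_half:
  assumes "a k = 2" shows "cf_head a (Suc k) \<le> 1/2"
  using head_Suc[of k] head_mem[of k] assms frac_le[of 1 1 2 "2 + cf_head a k"] by simp

lemma val_one_le:
  assumes "a k = 1" shows "cf_val a k \<le> 3"
  using tail_mem[of "Suc k"] head_mem[of k] assms by (simp add: cf_val_def)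

text \<open>With \<open>x\<close> to the right and \<open>y\<close> to the left of the pair, the
  first 2 has value \<open>2 + 1 / (2 + x) + y\<close>; at the second 2 the roles of
  \<open>x\<close> and \<open>y\<close> swap.\<close>

lemma val_pair_near_three:
  assumes ones_left: "\<And>j. j < N \<Longrightarrow> a (k + j) = 1" and two: "a (k + N) = 2" "a (Suc (k + N)) = 2"
    and ones_right: "\<And>j. j < N \<Longrightarrow> a (Suc (Suc (k + N)) + j) = 1"
  shows "\<bar>cf_val a (k + N) - 3\<bar> \<le> 2 * (2/3) ^ N" "\<bar>cf_val a (Suc (k + N)) - 3\<bar> \<le> 2 * (2/3) ^ N"
proof -
  define x y where "x = cf_tail a (Suc (Suc (k + N)))" and "y = cf_head a (k + N)"
  have nonneg: "0 \<le> x" "0 \<le> y"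
    using tail_mem[of "Suc (Suc (k + N))"] head_mem[of "k + N"] by (auto simp: x_def y_def)
  have "x = (gold_map ^^ N) (cf_tail a (Suc (Suc (k + N)) + N))"
    unfolding x_def by (rule tail_ones) (rule ones_right)
  moreover have "y = (gold_map ^^ N) (cf_head a k)"
    unfolding y_def by (rule head_ones) (rule ones_left)
  moreover have "cf_tail a (Suc (Suc (k + N)) + N) \<in> {0..1}"
    using tail_mem[of "Suc (Suc (k + N)) + N"] by simp
  ultimately have near: "\<bar>x - gold\<bar> \<le> (2/3) ^ N" "\<bar>y - gold\<bar> \<le> (2/3) ^ N"
    using gold_map_funpow_near head_mem by auto
  show "\<bar>cf_val a (k + N) - 3\<bar> \<le> 2 * (2/3) ^ N"
    using pair_value_near_three[OF nonneg(1) near] tail_unfold[of "Suc (k + N)"] two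
    by (simp add: cf_val_def x_def y_def)
  show "\<bar>cf_val a (Suc (k + N)) - 3\<bar> \<le> 2 * (2/3) ^ N"
    using pair_value_near_three[OF nonneg(2) near(2,1)] head_Suc[of "k + N"] two
    by (simp add: cf_val_def x_def y_def algebra_simps)
qed

lemma val_pair_ge:
  assumes "a k = 2" "a (Suc k) = 2" "gold + d \<le> cf_head a k" "cf_tail a (Suc (Suc k)) \<le> gold"
  shows "3 + d \<le> cf_val a k"
proof -
  have "1 / (2 + gold) \<le> 1 / (2 + cf_tail a (Suc (Suc k)))"
    using assms(4) tail_mem[of "Suc (Suc k)"] by (intro frac_le) auto
  then show ?thesis
    using assms tail_unfold[of "Suc k"] unfolding inverse_two_add_gold by (simp add: cf_val_def)
qed

end

section \<open>A continuous reduction of divergence to the fibre over 3\<close>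

text \<open>Each pair of 2s lies between two runs of 1s of length at least \<open>2m\<close>. The run to the left of
  the second pair has odd length; the run to its right, which extends into the next block, has
  even length.\<close>

definition block :: "nat \<Rightarrow> nat list" where
  "block m = replicate (2 * m) 1 @ [2, 2] @ replicate (Suc (2 * m)) 1 @ [2, 2] @ replicate (2 * m) 1"

lemma length_block: "length (block m) = 6 * m + 5"
  by (simp add: block_def)

lemma nth_block:
  assumes "j < 6 * m + 5"
  shows "block m ! j = (if j \<in> {2 * m, 2 * m + 1, 4 * m + 3, 4 * m + 4} then 2 else 1)"
proof -
  consider "j < 2 * m" | "j = 2 * m" | "j = 2 * m + 1" | "2 * m + 1 < j" "j < 4 * m + 3"
    | "j = 4 * m + 3" | "j = 4 * m + 4" | "4 * m + 4 < j"
    by linarith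
  then show ?thesis
    using assms by cases (auto simp: block_def nth_append nth_Cons')
qed

text \<open>Blocks are nonempty, so the first \<open>Suc t\<close> of them reach past position
  \<open>t\<close>. Digit \<open>t\<close> thus depends on finitely many entries of
  \<open>n\<close>, which gives continuity.\<close>

definition digits :: "(nat \<Rightarrow> nat) \<Rightarrow> nat \<Rightarrow> nat" where
  "digits n t = concat (map (\<lambda>i. block (n i)) [0..<Suc t]) ! t"

definition start :: "(nat \<Rightarrow> nat) \<Rightarrow> nat \<Rightarrow> nat" where
  "start n i = length (concat (map (\<lambda>i. block (n i)) [0..<i]))"

lemma start_Suc: "start n (Suc i) = start n i + (6 * n i + 5)"
  by (simp add: start_def length_block)

lemma start_ge: "i \<le> start n i"
  by (induction i) (auto simp: start_Suc)

lemma digits_start: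
  assumes "j < 6 * n i + 5"
  shows "digits n (start n i + j) = block (n i) ! j"
proof -
  define t where "t = start n i + j"
  have "i \<le> t"
    using start_ge[of i n] by (simp add: t_def)
  then have "[0..<Suc t] = [0..<i] @ [i] @ [Suc i..<Suc t]"
    using upt_add_eq_append[of 0 i "Suc t - i"] by (simp add: upt_conv_Cons)
  then show ?thesis
    unfolding digits_def t_def[symmetric]
    using assms by (simp add: nth_append length_block t_def start_def)
qed

lemma digits_cong: "(\<And>i. i < L \<Longrightarrow> m i = n i) \<Longrightarrow> t < L \<Longrightarrow> digits m t = digits n t"
  unfolding digits_def by (intro arg_cong2[where f = nth] arg_cong[where f = concat] map_cong) auto

lemma digits_cases:
  assumes "start n K \<le> t"
  obtains i j where "K \<le> i" "t = start n i + j" "j < 6 * n i + 5"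
    "digits n t = (if j \<in> {2 * n i, 2 * n i + 1, 4 * n i + 3, 4 * n i + 4} then 2 else 1)"
proof -
  obtain i where i: "K \<le> i" "start n i \<le> t" "t < start n (Suc i)"
    using between_steps[OF start_ge assms] by blast
  then obtain j where j: "t = start n i + j" "j < 6 * n i + 5"
    by (metis add_less_cancel_left le_iff_add start_Suc)
  with i(1) show ?thesis
    using that digits_start[of j n i] nth_block[of j "n i"] by simp
qed

lemma digits_eq:
  assumes "j < 6 * n i + 5"
  shows "digits n (start n i + j) = (if j \<in> {2 * n i, 2 * n i + 1, 4 * n i + 3, 4 * n i + 4} then 2 else 1)"
  using digits_start[of j n i] nth_block[of j "n i"] assms by simp

global_interpretation digits: one_two_cf "digits n" for n
proof
  show "digits n t \<in> {1, 2}" for t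
    by (rule digits_cases[of n 0 t]) (auto simp: start_def)
qed

lemma digits_val_near_three:
  assumes "j \<in> {2 * n i, 2 * n i + 1, 4 * n i + 3, 4 * n i + 4}"
  shows "\<bar>cf_val (digits n) (start n i + j) - 3\<bar> \<le> 2 * (2/3) ^ (2 * n i)"
proof -
  have eq: "digits n (start n i + k + j) = digits n (start n i + (k + j))"
    "digits n (Suc (start n i + k + j)) = digits n (start n i + (Suc (k + j)))"
    "digits n (Suc (Suc (start n i + k + j)) + l) = digits n (start n i + (Suc (Suc (k + j)) + l))" for k j l
    by (simp_all add: algebra_simps)
  \<comment> \<open>Here \<open>k\<close> is where the last \<open>2 * n i\<close> ones before a
    pair begin; the offset \<open>2 * n i + 3\<close> skips the first 1 of the odd run.\<close>
  have "\<bar>cf_val (digits n) (start n i + k + 2 * n i) - 3\<bar> \<le> 2 * (2/3) ^ (2 * n i) \<and>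
        \<bar>cf_val (digits n) (Suc (start n i + k + 2 * n i)) - 3\<bar> \<le> 2 * (2/3) ^ (2 * n i)"
    if "k \<in> {0, 2 * n i + 3}" for k
    using that
    by (intro conjI digits.val_pair_near_three; unfold eq; subst digits_eq) auto
  from this[of 0] this[of "2 * n i + 3"] show ?thesis
    using assms by (auto simp: algebra_simps)
qed

lemma digits_val_gap: "3 + odd_gap (n i) \<le> cf_val (digits n) (start n i + (4 * n i + 3))"
proof (rule digits.val_pair_ge)
  define b where "b = start n i"
  show "digits n (start n i + (4 * n i + 3)) = 2"
    using digits_eq[of "4 * n i + 3" n i] by simp
  have "Suc (start n i + (4 * n i + 3)) = start n i + (4 * n i + 4)"
    by simp
  then show "digits n (Suc (start n i + (4 * n i + 3))) = 2"
    using digits_eq[of "4 * n i + 4" n i] by (simp only:) simp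
  \<comment> \<open>Left side: the odd run starts right after the first pair, at offset
    \<open>2 * n i + 2\<close>.\<close>
  have "cf_head (digits n) (b + (2 * n i + 2) + Suc (2 * n i))
      = (gold_map ^^ Suc (2 * n i)) (cf_head (digits n) (b + (2 * n i + 2)))"
  proof (rule digits.head_ones)
    fix j assume "j < Suc (2 * n i)"
    then show "digits n (b + (2 * n i + 2) + j) = 1"
      using digits_eq[of "2 * n i + 2 + j" n i] by (simp add: b_def add.assoc)
  qed
  also have "b + (2 * n i + 2) + Suc (2 * n i) = start n i + (4 * n i + 3)"
    by (simp add: b_def)
  finally have "cf_head (digits n) (start n i + (4 * n i + 3))
      = (gold_map ^^ Suc (2 * n i)) (cf_head (digits n) (b + (2 * n i + 2)))" .
  moreover have "cf_head (digits n) (b + (2 * n i + 2)) \<le> 1/2"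
    using digits_eq[of "2 * n i + 1" n i] digits.head_le_half[of n "b + (2 * n i + 1)"]
    by (simp add: b_def)
  ultimately show "gold + odd_gap (n i) \<le> cf_head (digits n) (start n i + (4 * n i + 3))"
    using gold_map_funpow_odd_ge[of "cf_head (digits n) (b + (2 * n i + 2))" "n i"]
      digits.head_mem[of n "b + (2 * n i + 2)"]
    by (simp add: odd_gap_def del: funpow.simps)
  \<comment> \<open>Right side: every block opens with an even run ended by a 2, whose tail is at
    most 1/2. The even run closing the current block then preserves the bound.\<close>
  have next_le: "cf_tail (digits n) (start n k) \<le> gold" for k
  proof -
    have "cf_tail (digits n) (start n k) = (gold_map ^^ (2 * n k)) (cf_tail (digits n) (start n k + 2 * n k))"
      by (rule digits.tail_ones) (simp add: digits_eq)
    moreover have "cf_tail (digits n) (start n k + 2 * n k) \<le> 1/2"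
      by (rule digits.tail_le_half) (simp add: digits_eq)
    ultimately show ?thesis
      using gold_map_funpow_even_le_gold[of "cf_tail (digits n) (start n k + 2 * n k)" "n k"]
        digits.tail_mem[of n "start n k + 2 * n k"] gold_bounds by simp
  qed
  have "cf_tail (digits n) (b + (4 * n i + 5)) = (gold_map ^^ (2 * n i)) (cf_tail (digits n) (b + (4 * n i + 5) + 2 * n i))"
  proof (rule digits.tail_ones)
    fix j assume "j < 2 * n i"
    then show "digits n (b + (4 * n i + 5) + j) = 1"
      using digits_eq[of "4 * n i + 5 + j" n i] by (simp add: b_def add.assoc)
  qed
  also have "b + (4 * n i + 5) + 2 * n i = start n (Suc i)"
    by (simp add: b_def start_Suc)
  also have "(gold_map ^^ (2 * n i)) (cf_tail (digits n) (start n (Suc i))) \<le> gold"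
    using digits.tail_mem[of n "start n (Suc i)"] by (intro gold_map_funpow_even_le_gold next_le) auto
  also have "b + (4 * n i + 5) = Suc (Suc (start n i + (4 * n i + 3)))"
    by (simp add: b_def)
  finally show "cf_tail (digits n) (Suc (Suc (start n i + (4 * n i + 3)))) \<le> gold" .
qed

lemma approx_const_digits_eq_3:
  assumes lim: "filterlim n at_top sequentially"
  shows "approx_const (cf_tail (digits n) 0) = 3"
proof -
  have near: "\<exists>K. \<forall>i\<ge>K. 2 * (2/3) ^ (2 * n i) < e" if "e > 0" for e :: real
  proof -
    obtain B where B: "(2/3) ^ B < e / 2"
      using real_arch_pow_inv[of "e / 2" "2/3"] \<open>e > 0\<close> by auto
    obtain K where K: "\<And>i. K \<le> i \<Longrightarrow> B \<le> n i"
      using lim by (auto simp: filterlim_at_top eventually_sequentially)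
    have "2 * (2/3) ^ (2 * n i) < e" if "K \<le> i" for i
    proof -
      have "(2/3 :: real) ^ (2 * n i) \<le> (2/3) ^ B"
        using K[OF that] by (intro power_decreasing) auto
      with B show ?thesis by linarith
    qed
    then show ?thesis by blast
  qed
  have "approx_const (cf_tail (digits n) 0) \<le> ereal (3 + e)" if pos: "e > 0" for e
  proof -
    obtain K where K: "\<And>i. K \<le> i \<Longrightarrow> 2 * (2/3) ^ (2 * n i) < e"
      using near[OF pos] by blast
    have "cf_val (digits n) t \<le> 3 + e" if "start n K \<le> t" for t
    proof (rule digits_cases[OF that])
      fix i j
      assume i: "K \<le> i" and t: "t = start n i + j" and digit:
        "digits n t = (if j \<in> {2 * n i, 2 * n i + 1, 4 * n i + 3, 4 * n i + 4} then 2 else 1)"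
      show "cf_val (digits n) t \<le> 3 + e"
      proof (cases "j \<in> {2 * n i, 2 * n i + 1, 4 * n i + 3, 4 * n i + 4}")
        case True
        then show ?thesis
          using digits_val_near_three[of j n i, OF True] K[OF i] unfolding t by linarith
      next
        case False
        then show ?thesis
          using digits.val_one_le[of n t] digit pos by simp
      qed
    qed
    then show ?thesis
      using pos by (intro digits.approx_const_le_of_val[of _ "start n K"]) simp_all
  qed
  then have upper: "approx_const (cf_tail (digits n) 0) \<le> 3"
    by - (rule ereal_le_epsilon2, simp)
  have lower: "ereal (3 - e) \<le> approx_const (cf_tail (digits n) 0)" if "e > 0" "e < 3" for e
  proof (rule digits.approx_const_ge_of_val)
    fix N
    obtain K where K: "\<And>i. K \<le> i \<Longrightarrow> 2 * (2/3) ^ (2 * n i) < e"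
      using near[OF \<open>e > 0\<close>] by blast
    define i where "i = max N K"
    have "\<bar>cf_val (digits n) (start n i + 2 * n i) - 3\<bar> \<le> 2 * (2/3) ^ (2 * n i)"
      by (rule digits_val_near_three) simp
    moreover have "2 * (2/3) ^ (2 * n i) < e"
      by (rule K) (simp add: i_def)
    ultimately have "3 - e < cf_val (digits n) (start n i + 2 * n i)"
      by linarith
    moreover have "N \<le> start n i + 2 * n i"
      using start_ge[of i n] by (simp add: i_def)
    ultimately show "\<exists>t\<ge>N. 3 - e < cf_val (digits n) t"
      by blast
  qed (use that in simp)
  have "3 \<le> approx_const (cf_tail (digits n) 0)"
  proof (rule ereal_le_epsilon2)
    fix e :: real assume "0 < e"
    \<comment> \<open>Capping \<open>e\<close> at 1 keeps the constant \<open>3 - min e 1\<close>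
      positive, as \<open>lower\<close> requires.\<close>
    then have "ereal (3 - min e 1) + ereal (min e 1) \<le> approx_const (cf_tail (digits n) 0) + ereal e"
      by (intro add_mono lower) auto
    moreover have "ereal (3 - min e 1) + ereal (min e 1) = 3"
      unfolding plus_ereal.simps by simp
    ultimately show "3 \<le> approx_const (cf_tail (digits n) 0) + ereal e"
      by (simp only:)
  qed
  with upper show ?thesis
    by (rule antisym)
qed

lemma approx_const_digits_gt_3:
  assumes "\<not> filterlim n at_top sequentially"
  shows "approx_const (cf_tail (digits n) 0) > 3"
proof -
  \<comment> \<open>Some bound \<open>Z\<close> is undercut infinitely often; by pigeonhole a single
    value \<open>m\<close> recurs.\<close>
  obtain Z where "\<exists>\<^sub>F i in sequentially. n i \<in> {..<Z}"
    using assms by (auto simp: filterlim_at_top not_eventually not_le)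
  then obtain m where m: "\<exists>\<^sub>F i in sequentially. n i = m"
    using frequently_bex_finite_distrib[of "{..<Z}" "\<lambda>i m. n i = m" sequentially]
    by (auto simp: Bex_def)
  \<comment> \<open>Halving the gap yields the strict inequality that the criterion asks
    for.\<close>
  have "ereal (3 + odd_gap m / 2) \<le> approx_const (cf_tail (digits n) 0)"
  proof (rule digits.approx_const_ge_of_val)
    fix N
    obtain i where "N \<le> i" "n i = m"
      using m by (auto simp: frequently_sequentially)
    then show "\<exists>t\<ge>N. 3 + odd_gap m / 2 < cf_val (digits n) t"
      using digits_val_gap[of n i] odd_gap_pos[of m] start_ge[of i n]
      by (intro exI[of _ "start n i + (4 * n i + 3)"]) auto
  qed (use odd_gap_pos[of m] in simp)
  moreover have "3 < ereal (3 + odd_gap m / 2)"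
    using odd_gap_pos[of m] by (simp add: numeral_eq_ereal)
  ultimately show ?thesis
    by (rule less_le_trans[rotated])
qed

interpretation reduction: divergence_reduction "\<lambda>n. cf_tail (digits n) 0" "approx_const_fiber 3"
proof
  fix n :: "nat \<Rightarrow> nat" and U :: "real set"
  assume "open U" "cf_tail (digits n) 0 \<in> U"
  then obtain e where "e > 0" and e: "\<And>y. dist y (cf_tail (digits n) 0) < e \<Longrightarrow> y \<in> U"
    by (auto simp: open_dist)
  obtain L where L: "(9/16) ^ L < e"
    using real_arch_pow_inv[of e "9/16"] \<open>e > 0\<close> by auto
  have "cf_tail (digits m) 0 \<in> U" if "\<forall>i<L. m i = n i" for m
    using tail_close[OF digits.one_two_cf_axioms digits.one_two_cf_axioms, of L m n]
      digits_cong[of L m n] that L by (intro e) (simp add: dist_real_def)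
  then show "\<exists>L. \<forall>m. (\<forall>i<L. m i = n i) \<longrightarrow> cf_tail (digits m) 0 \<in> U"
    by blast
next
  fix n :: "nat \<Rightarrow> nat"
  show "cf_tail (digits n) 0 \<in> approx_const_fiber 3 \<longleftrightarrow> filterlim n at_top sequentially"
    using approx_const_digits_eq_3 approx_const_digits_gt_3 digits.irrational
    by (force simp: approx_const_fiber_def)
qed

theorem theorem1p3:
  shows "\<not> gdelta (approx_const_fiber 3) \<and> \<not> fsigma (approx_const_fiber 3) \<and>
         fsigma_delta (approx_const_fiber 3)"
  using reduction.not_gdelta reduction.not_fsigma fsigma_delta_approx_const_fiber[of 3] by simp

end
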